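(* Let $n\ge1$ and let $\mathrm{CMP}(n)$ be the set of binary words $\mathbf b=(b_1,\dots,b_{2n})$ which arise from pairs $(x_0,\mathbf b)$ with $x_0\in\{1,\dots,n\}$, $\mathbf b$ having $n$ zeros and $n$ ones, $b_{2n}=1$, $b_i=1-b_{n+i}$ for all $i\in\{1,\dots,n\}$, such that the lattice path from $(x_0,0)$ taking an east step for each $0$ and a north step for each $1$ never visits a lattice point on the lines $y=x$ or $y=x-(n+2)$. Let $\mathrm{OBW}(n)$ be the set of binary words of length $n$ with an odd number of ones, and let $M:\mathrm{OBW}(n)\to\mathrm{CMP}(n)$ be the bijection $M(b_1,\dots,b_n)=(b_1,\dots,b_{n-1},0,1-b_1,\dots,1-b_{n-1},1)$. Let $\eta(b_1,\dots,b_n)=(1-b_{n-1},1-b_n,b_1,\dots,b_{n-2})$ (which preserves $\mathrm{OBW}(n)$) and let $\tilde\eta=M\circ\eta\circ M^{-1}$, generating a cyclic group $\langle\tilde\eta\rangle$ of order $n$ acting on $\mathrm{CMP}(n)$. Then both \[ \left(\mathrm{CMP}(n),\langle\tilde\eta\rangle,\frac12\sum_{k=0}^n q^{\binom{k}{2}}\genfrac{[}{]}{0pt}{}{n}{k}_q\right)\quad\text{and}\quad\left(\mathrm{CMP}(n),\langle\tilde\eta\rangle,\sum_{\mathbf b\in\mathrm{CMP}(n)}q^{\mathrm{maj}(\mathbf b)}\right) \] exhibit the cyclic sieving phenomenon.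
   Context: $\mathrm{maj}(\mathbf b)=\sum\{i: b_i>b_{i+1}\}$. A triple $(X,C_n,f(q))$, $C_n=\langle g\rangle$ cyclic of order $n$ acting on the finite set $X$, $f$ a polynomial with non-negative integer coefficients, exhibits the cyclic sieving phenomenon if $f(\omega_n^k)=|\{x\in X: g^k\cdot x=x\}|$ for all $k\in\{1,\dots,n\}$, $\omega_n=e^{2\pi i/n}$. *)

theory Defs
  imports
    Complex_Main
    "HOL-Computational_Algebra.Polynomial"
    "HOL-Algebra.Group_Action"
    "HOL-Algebra.Elementary_Groups"
begin

text \<open>
  Binary words are lists over \<open>{0, 1}\<close>; the letter \<open>b\<^sub>i\<close> (indexed from 1) is \<open>b ! (i - 1)\<close>.
\<close>

definition binary_words :: "nat \<Rightarrow> nat list set" where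
  "binary_words m = {b. length b = m \<and> set b \<subseteq> {0, 1}}"

definition maj :: "nat list \<Rightarrow> nat" where
  "maj b = \<Sum>{i \<in> {1..<length b}. b ! (i - 1) > b ! i}"

text \<open>The lattice point reached after the first \<open>i\<close> steps of the path starting in \<open>(x\<^sub>0, 0)\<close>.\<close>

definition path_point :: "nat \<Rightarrow> nat list \<Rightarrow> nat \<Rightarrow> int \<times> int" where
  "path_point x0 b i = (int (x0 + count_list (take i b) 0), int (count_list (take i b) 1))"

definition CMP_pairs :: "nat \<Rightarrow> (nat \<times> nat list) set" where
  "CMP_pairs n = {(x0, b). x0 \<in> {1..n} \<and> b \<in> binary_words (2 * n)
     \<and> count_list b 0 = n \<and> count_list b 1 = n
     \<and> b ! (2 * n - 1) = 1
     \<and> (\<forall>i\<in>{1..n}. b ! (i - 1) = 1 - b ! (n + i - 1))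
     \<and> (\<forall>i\<in>{0..2 * n}. case path_point x0 b i of (x, y) \<Rightarrow> y \<noteq> x \<and> y \<noteq> x - (int n + 2))}"

definition CMP :: "nat \<Rightarrow> nat list set" where
  "CMP n = snd ` CMP_pairs n"

definition OBW :: "nat \<Rightarrow> nat list set" where
  "OBW n = {b \<in> binary_words n. odd (count_list b 1)}"

definition M_map :: "nat list \<Rightarrow> nat list" where
  "M_map b = butlast b @ [0] @ map (\<lambda>c. 1 - c) (butlast b) @ [1]"

text \<open>
  For \<open>n = 1\<close> the formula \<open>(1 - b\<^sub>n\<^sub>-\<^sub>1, 1 - b\<^sub>n, b\<^sub>1, \<dots>, b\<^sub>n\<^sub>-\<^sub>2)\<close> makes no literal sense.
  Reading words antiperiodically (\<open>b\<^sub>i\<^sub>-\<^sub>n = 1 - b\<^sub>i\<close>), it is the shift by two positions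
  for every \<open>n \<ge> 2\<close>, and this shift is the identity for \<open>n = 1\<close>; the identity is also the
  only self-map of the singleton \<open>OBW 1\<close>.
\<close>

definition eta :: "nat list \<Rightarrow> nat list" where
  "eta b = (let n = length b in
     if n \<le> 1 then b else [1 - b ! (n - 2), 1 - b ! (n - 1)] @ take (n - 2) b)"

text \<open>Restricted to \<open>CMP n\<close>, since elements of \<^const>\<open>BijGroup\<close> are extensional functions.\<close>

definition eta_tilde :: "nat \<Rightarrow> nat list \<Rightarrow> nat list" where
  "eta_tilde n = restrict (M_map \<circ> eta \<circ> inv_into (OBW n) M_map) (CMP n)"

definition perm_group_generated :: "'a set \<Rightarrow> ('a \<Rightarrow> 'a) \<Rightarrow> ('a \<Rightarrow> 'a) monoid" where
  "perm_group_generated X g = subgroup_generated (BijGroup X) {g}"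

text \<open>
  \<open>cyclic_sieving n X G g \<phi> f\<close>: the group \<open>G\<close> is cyclic of order \<open>n\<close> with generator \<open>g\<close>
  and acts on the finite set \<open>X\<close> via \<open>\<phi>\<close>, and \<open>(X, G, f)\<close> exhibits the cyclic sieving phenomenon.
\<close>

definition cyclic_sieving ::
  "nat \<Rightarrow> 'x set \<Rightarrow> ('g, 'm) monoid_scheme \<Rightarrow> 'g \<Rightarrow> ('g \<Rightarrow> 'x \<Rightarrow> 'x) \<Rightarrow> complex poly \<Rightarrow> bool" where
  "cyclic_sieving n X G g \<phi> f \<longleftrightarrow>
     finite X \<and> group_action G X \<phi>
     \<and> g \<in> carrier G \<and> subgroup_generated G {g} = G
     \<and> finite (carrier G) \<and> Coset.order G = n
     \<and> (\<forall>i. coeff f i \<in> \<nat>)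
     \<and> (\<forall>k\<in>{1..n}. poly f (exp (2 * complex_of_real pi * \<i> / of_nat n) ^ k)
           = of_nat (card {x \<in> X. \<phi> (g [^]\<^bsub>G\<^esub> k) x = x}))"

definition q_int :: "nat \<Rightarrow> 'a::field poly" where
  "q_int n = (\<Sum>i<n. monom 1 i)"

definition q_fact :: "nat \<Rightarrow> 'a::field poly" where
  "q_fact n = (\<Prod>i=1..n. q_int i)"

text \<open>The polynomial division is exact, see \<open>q_binomial_mult\<close> below.\<close>

definition q_binomial :: "nat \<Rightarrow> nat \<Rightarrow> 'a::field poly" where
  "q_binomial n k = (if k \<le> n then q_fact n div (q_fact k * q_fact (n - k)) else 0)"

lemma q_int_add: "q_int (k + m) = q_int k + monom 1 k * q_int m"
proof -
  have "q_int (k + m) = q_int k + (\<Sum>i=k..<k+m. monom 1 i :: 'a poly)"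
    unfolding q_int_def by (simp add: lessThan_atLeast0 sum.atLeastLessThan_concat)
  also have "(\<Sum>i=k..<k+m. monom 1 i :: 'a poly) = (\<Sum>i<m. monom 1 (k + i))"
    using sum.shift_bounds_nat_ivl[of "\<lambda>i. monom 1 i :: 'a poly" 0 k m]
    by (simp add: lessThan_atLeast0 add.commute)
  finally show ?thesis
    by (simp add: q_int_def sum_distrib_left mult_monom)
qed

lemma q_fact_Suc: "q_fact (Suc n) = q_int (Suc n) * q_fact n"
  by (simp add: q_fact_def mult.commute)

lemma q_fact_dvd: "q_fact k * q_fact m dvd (q_fact (k + m) :: 'a::field poly)"
proof (induction "k + m" arbitrary: k m)
  case 0
  then show ?case by (simp add: q_fact_def)
next
  case (Suc s)
  show ?case
  proof (cases "k = 0 \<or> m = 0")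
    case True
    then show ?thesis by (auto simp: q_fact_def)
  next
    case False
    then obtain k' m' where km: "k = Suc k'" "m = Suc m'"
      by (metis not0_implies_Suc)
    have 1: "q_fact k' * q_fact m dvd (q_fact s :: 'a poly)"
      using Suc.hyps(1)[of k' m] Suc.hyps(2) km by simp
    have 2: "q_fact k * q_fact m' dvd (q_fact s :: 'a poly)"
      using Suc.hyps(1)[of k m'] Suc.hyps(2) km by simp
    have "q_fact (k + m) = q_int (k + m) * (q_fact s :: 'a poly)"
      using Suc.hyps(2) q_fact_Suc by metis
    also have "\<dots> = q_int k * q_fact s + monom 1 k * (q_int m * q_fact s)"
      by (simp add: q_int_add algebra_simps)
    finally have eq: "q_fact (k + m) = q_int k * q_fact s + monom 1 k * (q_int m * q_fact s :: 'a poly)" .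
    have "q_fact k * q_fact m = q_int k * (q_fact k' * q_fact m :: 'a poly)"
      by (simp add: km q_fact_Suc mult.assoc)
    then have d1: "q_fact k * q_fact m dvd q_int k * (q_fact s :: 'a poly)"
      by (simp only: mult_dvd_mono[OF dvd_refl 1])
    have "q_fact k * q_fact m = q_int m * (q_fact k * q_fact m' :: 'a poly)"
      by (simp add: km q_fact_Suc mult_ac)
    then have d2: "q_fact k * q_fact m dvd q_int m * (q_fact s :: 'a poly)"
      by (simp only: mult_dvd_mono[OF dvd_refl 2])
    show ?thesis
      unfolding eq by (intro dvd_add dvd_mult d1 d2)
  qed
qed

lemma q_binomial_mult:
  "k \<le> n \<Longrightarrow> q_binomial n k * (q_fact k * q_fact (n - k)) = (q_fact n :: 'a::field poly)"
  using q_fact_dvd[of k "n - k", where 'a = 'a] by (simp add: q_binomial_def)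

end

theory Submission
  imports
    "HOL-Algebra.Multiplicative_Group"
    "HOL-Analysis.Complex_Transcendental"
    "HOL-Number_Theory.Cong"
    Defs
begin

text \<open>
  Read a word \<open>b\<close> of length \<open>n\<close> as a function on the integers with \<open>b(i + n) = 1 - b(i)\<close>; then
  \<open>\<eta>\<close> is the shift by two. Let \<open>m = gcd n k\<close> and \<open>d = n / m\<close>. A function fixed by \<open>\<eta>\<^sup>k\<close> has period
  \<open>2 m\<close>, which is incompatible with the antiperiod \<open>n\<close> if \<open>d\<close> is even, and turns it into the
  antiperiod \<open>m\<close> if \<open>d\<close> is odd. Hence \<open>\<eta>\<^sup>k\<close> has \<open>0\<close> or \<open>2\<^sup>m\<^sup>-\<^sup>1\<close> fixed points. On the other side,
  both polynomials agree at every \<open>n\<close>-th root of unity \<open>z\<close> with \<open>\<Prod>i=1..n-1. 1 + z\<^sup>i\<close>: the first one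
  by the \<open>q\<close>-binomial theorem, the second one because modulo \<open>n\<close> the major index of
  \<open>w 0 (1-w) 1\<close> is the sum of the positions where the word \<open>w 0\<close> changes its letter, and
  these positions form an arbitrary subset of \<open>{1..n-1}\<close>. For \<open>z\<close> of order \<open>d\<close> this product is
  \<open>0\<close> or \<open>2\<^sup>m\<^sup>-\<^sup>1\<close>, according to the parity of \<open>d\<close>.
\<close>

section \<open>The \<open>q\<close>-binomial theorem\<close>

lemma q_int_Suc_neq_0: "(q_int (Suc n) :: 'a::field poly) \<noteq> 0"
proof
  assume "q_int (Suc n) = (0 :: 'a poly)"
  then have "coeff (q_int (Suc n) :: 'a poly) 0 = 0"
    by simp
  then show False
    by (simp add: q_int_def coeff_sum sum.lessThan_Suc_shift del: sum.lessThan_Suc)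
qed

lemma q_fact_0: "q_fact 0 = 1"
  by (simp add: q_fact_def)

lemma q_fact_neq_0: "(q_fact n :: 'a::field poly) \<noteq> 0"
  by (induction n) (simp_all add: q_fact_0 q_fact_Suc q_int_Suc_neq_0)

lemma q_binomial_n_0: "q_binomial n 0 = (1 :: 'a::field poly)"
  using q_binomial_mult[of 0 n, where 'a='a] by (simp add: q_fact_neq_0 q_fact_0)

lemma q_binomial_n_n: "q_binomial n n = (1 :: 'a::field poly)"
  using q_binomial_mult[of n n, where 'a='a] by (simp add: q_fact_neq_0 q_fact_0)

lemma q_binomial_eq_0: "n < k \<Longrightarrow> q_binomial n k = 0"
  by (simp add: q_binomial_def)

text \<open>Of the two \<open>q\<close>-Pascal rules this is the one whose weight fits
  \<open>k choose 2\<close>. After multiplication by the common denominator it reduces to splitting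
  \<open>q_int (Suc n)\<close> as \<open>q_int (n - k) + q^(n - k) * q_int (Suc k)\<close>.\<close>

lemma q_binomial_Suc_Suc:
  "q_binomial (Suc n) (Suc k)
     = q_binomial n (Suc k) + monom 1 (n - k) * (q_binomial n k :: 'a::field poly)"
proof (cases k n rule: linorder_cases)
  case less
  define m where "m = n - Suc k"
  have n: "n = Suc (k + m)"
    using less by (simp add: m_def)
  let ?D = "q_fact (Suc k) * q_fact (Suc m) :: 'a poly"
  have "q_binomial (Suc n) (Suc k) * ?D = q_fact (Suc n)"
    using q_binomial_mult[of "Suc k" "Suc n", where 'a='a] n by simp
  also have "\<dots> = (q_int (Suc m) + monom 1 (Suc m) * q_int (Suc k)) * q_fact n"
    using q_int_add[of "Suc m" "Suc k", where 'a='a] by (simp add: q_fact_Suc n add.commute)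
  also have "\<dots> = q_int (Suc m) * (q_binomial n (Suc k) * (q_fact (Suc k) * q_fact m))
      + monom 1 (Suc m) * q_int (Suc k) * (q_binomial n k * (q_fact k * q_fact (Suc m)))"
    using q_binomial_mult[of "Suc k" n, where 'a='a] q_binomial_mult[of k n, where 'a='a] n
    by (simp add: algebra_simps Suc_diff_le)
  also have "\<dots> = (q_binomial n (Suc k) + monom 1 (n - k) * q_binomial n k) * ?D"
    using n by (simp add: q_fact_Suc algebra_simps Suc_diff_le)
  finally show ?thesis
    by (simp add: q_fact_neq_0)
qed (simp_all add: q_binomial_n_n q_binomial_eq_0 one_poly_eq_simps flip: one_pCons monom_eq_1)

text \<open>The \<open>q\<close>-binomial theorem at argument 1. In the induction step the second
  Pascal term acquires the weight \<open>q^n\<close>, independent of \<open>k\<close>, so that the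
  sum is multiplied by \<open>1 + q^n\<close>.\<close>

lemma q_binomial_sum:
  "(\<Sum>k=0..n. monom 1 (k choose 2) * q_binomial n k) = (\<Prod>i<n. 1 + monom (1::'a::field) i)"
proof (induction n)
  case 0
  then show ?case
    by (simp add: q_binomial_n_0 monom_eq_1 numeral_2_eq_2)
next
  case (Suc n)
  let ?S = "\<Sum>k=0..n. monom (1::'a) (k choose 2) * q_binomial n k"
  let ?T = "\<Sum>k=0..n. monom (1::'a) (Suc k choose 2) * q_binomial n (Suc k)"
  have split: "(\<Sum>k=0..Suc n. g k) = g 0 + (\<Sum>k=0..n. g (Suc k))" for g :: "nat \<Rightarrow> 'a poly"
    by (simp only: sum.atLeast0_atMost_Suc_shift) simp
  \<comment> \<open>The sum may be extended to \<open>k = Suc n\<close>, where the coefficient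
    vanishes, and its first term is 1.\<close>
  have S: "?S = 1 + ?T"
    using split[of "\<lambda>k. monom (1::'a) (k choose 2) * q_binomial n k"]
    by (simp add: q_binomial_n_0 q_binomial_eq_0 monom_eq_1 numeral_2_eq_2)
  have "(\<Sum>k=0..Suc n. monom (1::'a) (k choose 2) * q_binomial (Suc n) k)
      = 1 + (\<Sum>k=0..n. monom 1 (Suc k choose 2) * q_binomial (Suc n) (Suc k))"
    by (subst split) (simp add: q_binomial_n_0 monom_eq_1 numeral_2_eq_2)
  also have "(\<Sum>k=0..n. monom (1::'a) (Suc k choose 2) * q_binomial (Suc n) (Suc k))
      = (\<Sum>k=0..n. monom (1::'a) (Suc k choose 2) * q_binomial n (Suc k)
          + monom 1 n * (monom (1::'a) (k choose 2) * q_binomial n k))"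
  proof (rule sum.cong)
    fix k assume "k \<in> {0..n}"
    then have "(Suc k choose 2) + (n - k) = n + (k choose 2)"
      by (simp add: numeral_2_eq_2)
    then have "monom (1::'a) (Suc k choose 2) * monom 1 (n - k) = monom 1 n * monom 1 (k choose 2)"
      by (simp add: mult_monom)
    then show "monom (1::'a) (Suc k choose 2) * q_binomial (Suc n) (Suc k)
        = monom 1 (Suc k choose 2) * q_binomial n (Suc k)
          + monom 1 n * (monom 1 (k choose 2) * q_binomial n k)"
      by (simp only: q_binomial_Suc_Suc distrib_left flip: mult.assoc)
  qed simp
  also have "1 + \<dots> = ?S + monom 1 n * ?S"
    unfolding S by (simp add: sum.distrib sum_distrib_left flip: S)
  also have "\<dots> = (1 + monom 1 n) * ?S"
    by (simp add: algebra_simps)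
  finally show ?case
    using Suc by (simp add: mult.commute)
qed

text \<open>The factor for \<open>i = 0\<close> equals 2 and cancels the \<open>1 / 2\<close>; the
  product form also makes the coefficients visibly natural numbers.\<close>

lemma half_q_binomial_sum:
  assumes "n \<ge> 1"
  shows "smult (1 / 2) (\<Sum>k=0..n. monom 1 (k choose 2) * q_binomial n k)
    = (\<Prod>i\<in>{1..<n}. 1 + monom (1::'a::field_char_0) i)"
proof -
  have "{..<n} = insert 0 {1..<n}"
    using assms by auto
  then have "(\<Prod>i<n. 1 + monom (1::'a) i) = 2 * (\<Prod>i\<in>{1..<n}. 1 + monom 1 i)"
    by (simp add: monom_eq_1)
  then show ?thesis
    by (simp add: q_binomial_sum numeral_poly)
qed

lemma sum_in_Nats: "(\<And>x. x \<in> A \<Longrightarrow> f x \<in> \<nat>) \<Longrightarrow> (\<Sum>x\<in>A. f x) \<in> \<nat>"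
  by (induction A rule: infinite_finite_induct) auto

lemma coeff_prod_in_Nats:
  fixes f :: "'b \<Rightarrow> 'a::comm_semiring_1 poly"
  assumes "\<And>x i. x \<in> A \<Longrightarrow> coeff (f x) i \<in> \<nat>"
  shows "coeff (\<Prod>x\<in>A. f x) i \<in> \<nat>"
  using assms
proof (induction A arbitrary: i rule: infinite_finite_induct)
  case (insert x F)
  then show ?case
    by (auto simp: coeff_mult intro!: sum_in_Nats Nats_mult)
qed simp_all

section \<open>Products over roots of unity\<close>

definition primitive_root_of_unity :: "nat \<Rightarrow> 'a::idom \<Rightarrow> bool" where
  "primitive_root_of_unity d z \<longleftrightarrow> (\<forall>j. z ^ j = 1 \<longleftrightarrow> d dvd j)"

text \<open>The \<open>j\<close>-th power is 1 iff \<open>n dvd k * j\<close>; dividing by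
  \<open>gcd n k\<close> leaves a modulus coprime to the cofactor of \<open>j\<close>.\<close>

lemma primitive_root_of_unity_exp_power:
  assumes "n \<ge> 1"
  shows "primitive_root_of_unity (n div gcd n k) (exp (2 * complex_of_real pi * \<i> / of_nat n) ^ k)"
  unfolding primitive_root_of_unity_def
proof
  fix j
  have "(exp (2 * complex_of_real pi * \<i> / of_nat n) ^ k) ^ j
      = exp (2 * complex_of_real pi * \<i> * of_nat (k * j) / of_nat n)"
    by (simp add: power_mult[symmetric] exp_of_nat_mult[symmetric] mult_ac)
  then have "(exp (2 * complex_of_real pi * \<i> / of_nat n) ^ k) ^ j = 1 \<longleftrightarrow> n dvd k * j"
    by (simp only: complex_root_unity_eq_1[OF assms])
  also have "\<dots> \<longleftrightarrow> n div gcd n k dvd j"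
  proof -
    have "coprime (n div gcd n k) (k div gcd n k)"
      using assms by (intro div_gcd_coprime) simp
    moreover have "n dvd k * j \<longleftrightarrow> gcd n k * (n div gcd n k) dvd gcd n k * ((k div gcd n k) * j)"
      by (simp flip: mult.assoc)
    moreover have "\<dots> \<longleftrightarrow> n div gcd n k dvd (k div gcd n k) * j"
      using assms by (subst dvd_times_left_cancel_iff) auto
    ultimately show ?thesis
      by (simp add: coprime_dvd_mult_right_iff)
  qed
  finally show "(exp (2 * complex_of_real pi * \<i> / of_nat n) ^ k) ^ j = 1 \<longleftrightarrow> n div gcd n k dvd j" .
qed

text \<open>With \<open>d = 2 * e\<close>, the element \<open>z ^ e\<close> squares to 1 without
  being 1, so it is \<open>-1\<close> and the factor for \<open>i = e\<close> vanishes.\<close>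

lemma prod_one_plus_primitive_root_even:
  fixes z :: "'a::idom"
  assumes z: "primitive_root_of_unity d z" and "even d" "d > 0" "d dvd n" "n > 0"
  shows "(\<Prod>i\<in>{1..<n}. 1 + z ^ i) = 0"
proof -
  obtain e where e: "d = 2 * e" "e > 0"
    using assms by auto
  have "(z ^ e) ^ 2 = 1"
    using z e by (auto simp: primitive_root_of_unity_def mult.commute simp flip: power_mult)
  moreover have "z ^ e \<noteq> 1"
    using z e by (auto simp: primitive_root_of_unity_def dest: dvd_imp_le)
  ultimately have "1 + z ^ e = 0"
    by (simp add: power2_eq_1_iff)
  moreover have "e \<in> {1..<n}"
    using e assms by (auto dest!: dvd_imp_le)
  ultimately show ?thesis
    by (meson finite_atLeastLessThan prod_zero)
qed

text \<open>For odd \<open>d\<close>, doubling permutes the nonzero residues, and \<open>1 - z\<^sup>2\<^sup>i = (1 - z\<^sup>i) (1 + z\<^sup>i)\<close>.\<close>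

lemma prod_one_plus_primitive_root_odd:
  fixes z :: "'a::idom"
  assumes z: "primitive_root_of_unity d z" and "odd d"
  shows "(\<Prod>i<d. 1 + z ^ i) = 2"
proof -
  have d: "d > 0"
    using assms(2) by (auto intro: Nat.gr0I)
  have zmod: "z ^ (i mod d) = z ^ i" for i
  proof -
    have "z ^ i = z ^ (d * (i div d) + i mod d)"
      by simp
    also have "\<dots> = z ^ (i mod d)"
      using z by (simp only: power_add) (simp add: primitive_root_of_unity_def)
    finally show ?thesis by simp
  qed
  have cop: "coprime d 2"
    using assms(2) by simp
  have inj: "inj_on (\<lambda>i. 2 * i mod d) {1..<d}"
  proof (rule inj_onI)
    fix x y assume xy: "x \<in> {1..<d}" "y \<in> {1..<d}" "2 * x mod d = 2 * y mod d"
    then have "[2 * x = 2 * y] (mod d)"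
      by (simp add: cong_def)
    then have "[x = y] (mod d)"
      using cop by (simp add: cong_mult_lcancel_nat coprime_commute)
    then show "x = y"
      using xy by (simp add: cong_def)
  qed
  have "(\<lambda>i. 2 * i mod d) ` {1..<d} \<subseteq> {1..<d}"
  proof safe
    fix i assume i: "i \<in> {1..<d}"
    have "\<not> d dvd 2 * i"
      using i cop by (auto simp: coprime_dvd_mult_right_iff dest: dvd_imp_le)
    then have "2 * i mod d \<noteq> 0"
      by (simp add: dvd_eq_mod_eq_0)
    then show "2 * i mod d \<in> {1..<d}"
      using d by simp
  qed
  then have "(\<lambda>i. 2 * i mod d) ` {1..<d} = {1..<d}"
    using inj by (intro endo_inj_surj) auto
  then have "(\<Prod>i\<in>{1..<d}. 1 - z ^ i) = (\<Prod>i\<in>(\<lambda>i. 2 * i mod d) ` {1..<d}. 1 - z ^ i)"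
    by simp
  also have "\<dots> = (\<Prod>i\<in>{1..<d}. 1 - z ^ (2 * i))"
    by (subst prod.reindex[OF inj]) (simp add: zmod)
  also have "\<dots> = (\<Prod>i\<in>{1..<d}. 1 - z ^ i) * (\<Prod>i\<in>{1..<d}. 1 + z ^ i)"
    by (simp add: algebra_simps mult_2_right power_add flip: prod.distrib)
  finally have "(\<Prod>i\<in>{1..<d}. 1 - z ^ i) * ((\<Prod>i\<in>{1..<d}. 1 + z ^ i) - 1) = 0"
    by (simp add: algebra_simps)
  moreover have "(\<Prod>i\<in>{1..<d}. 1 - z ^ i) \<noteq> 0"
    using z by (auto simp: primitive_root_of_unity_def dest: dvd_imp_le)
  ultimately have "(\<Prod>i\<in>{1..<d}. 1 + z ^ i) = 1"
    by simp
  moreover have "{..<d} = insert 0 {1..<d}"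
    using d by auto
  ultimately show ?thesis
    by simp
qed

text \<open>The exponents below \<open>m * d\<close> split into \<open>m\<close> blocks of
  \<open>d\<close> consecutive ones, each contributing 2. The factor for \<open>i = 0\<close> is
  itself 2 and is cancelled at the end, which uses characteristic 0.\<close>

lemma prod_one_plus_primitive_root:
  fixes z :: "'a::{idom, ring_char_0}"
  assumes z: "primitive_root_of_unity d z" and "odd d" and "m > 0"
  shows "(\<Prod>i\<in>{1..<m * d}. 1 + z ^ i) = 2 ^ (m - 1)"
proof -
  have d: "d > 0"
    using assms(2) by (auto intro: Nat.gr0I)
  have "(\<Prod>i<m * d. 1 + z ^ i) = (\<Prod>j<m. \<Prod>i\<in>{j * d..<j * d + d}. 1 + z ^ i)"
    by (simp add: prod.nat_group)
  also have "\<dots> = (\<Prod>j<m. \<Prod>i<d. 1 + z ^ i)"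
  proof (rule prod.cong)
    fix j
    have "(\<Prod>i\<in>{j * d..<j * d + d}. 1 + z ^ i) = (\<Prod>i<d. 1 + z ^ (j * d + i))"
      using prod.shift_bounds_nat_ivl[of "\<lambda>i. 1 + z ^ i" 0 "j * d" d]
      by (simp add: lessThan_atLeast0 add.commute)
    also have "\<dots> = (\<Prod>i<d. 1 + z ^ i)"
    proof -
      have "z ^ (j * d) = 1"
        using z by (simp add: primitive_root_of_unity_def)
      then show ?thesis
        by (simp add: power_add)
    qed
    finally show "(\<Prod>i\<in>{j * d..<j * d + d}. 1 + z ^ i) = (\<Prod>i<d. 1 + z ^ i)" .
  qed simp
  also have "\<dots> = 2 * 2 ^ (m - 1)"
    using \<open>m > 0\<close> by (simp add: prod_one_plus_primitive_root_odd[OF assms(1,2)] flip: power_Suc)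
  finally have "(\<Prod>i<m * d. 1 + z ^ i) = 2 * 2 ^ (m - 1)" .
  moreover have "{..<m * d} = insert 0 {1..<m * d}"
    using d \<open>m > 0\<close> by (auto simp: Suc_le_eq)
  ultimately show ?thesis
    by simp
qed

section \<open>Antiperiodic words\<close>

definition antiperiodic :: "nat \<Rightarrow> (int \<Rightarrow> bool) set" where
  "antiperiodic n = {f. \<forall>i. f (i + int n) \<longleftrightarrow> \<not> f i}"

text \<open>The antiperiodic extension of a word: \<open>\<noteq>\<close> serves as exclusive or, so
  the letter at the residue is flipped once for each period crossed. Since \<open>div\<close> rounds
  down, negative positions are covered.\<close>

definition anti_ext :: "nat list \<Rightarrow> int \<Rightarrow> bool" where
  "anti_ext b i \<longleftrightarrow> (b ! nat (i mod int (length b)) = 1) \<noteq> odd (i div int (length b))"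

lemma antiperiodic_add_mult:
  assumes "f \<in> antiperiodic n"
  shows "f (i + int n * j) \<longleftrightarrow> (f i \<noteq> odd j)"
proof (induction j rule: int_induct[where k = 0])
  case (step1 j)
  have "f (i + int n * (j + 1)) = f (i + int n * j + int n)"
    by (simp add: algebra_simps)
  also have "\<dots> = (\<not> f (i + int n * j))"
    using assms by (simp only: antiperiodic_def mem_Collect_eq)
  finally show ?case
    using step1 by auto
next
  case (step2 j)
  have "f (i + int n * j) = f (i + int n * (j - 1) + int n)"
    by (simp add: algebra_simps)
  also have "\<dots> = (\<not> f (i + int n * (j - 1)))"
    using assms by (simp only: antiperiodic_def mem_Collect_eq)
  finally show ?case
    using step2 by auto
qed simp

lemma antiperiodic_eqI:
  assumes "f \<in> antiperiodic n" "g \<in> antiperiodic n" "n > 0"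
    and "\<And>i. 0 \<le> i \<Longrightarrow> i < int n \<Longrightarrow> f i = g i"
  shows "f = g"
proof
  fix i
  have "f (i mod int n + int n * (i div int n)) = g (i mod int n + int n * (i div int n))"
    unfolding antiperiodic_add_mult[OF assms(1)] antiperiodic_add_mult[OF assms(2)]
    using assms(3,4) by simp
  then show "f i = g i"
    by simp
qed

lemma anti_ext_antiperiodic: "length b = n \<Longrightarrow> n > 0 \<Longrightarrow> anti_ext b \<in> antiperiodic n"
  by (auto simp: antiperiodic_def anti_ext_def)

lemma anti_ext_nth: "j < length b \<Longrightarrow> anti_ext b (int j) \<longleftrightarrow> b ! j = 1"
  by (simp add: anti_ext_def)

lemma binary_words_nth: "b \<in> binary_words n \<Longrightarrow> j < n \<Longrightarrow> b ! j = 0 \<or> b ! j = 1"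
  unfolding binary_words_def using nth_mem[of j b] by blast

lemma binary_words_eqI:
  assumes "b \<in> binary_words n" "c \<in> binary_words n"
    and "\<And>j. j < n \<Longrightarrow> b ! j = 1 \<longleftrightarrow> c ! j = 1"
  shows "b = c"
proof (rule nth_equalityI)
  show "length b = length c"
    using assms(1,2) by (simp add: binary_words_def)
  fix j assume "j < length b"
  then have "j < n"
    using assms(1) by (simp add: binary_words_def)
  then show "b ! j = c ! j"
    using binary_words_nth[OF assms(1)] binary_words_nth[OF assms(2)] assms(3) by metis
qed

lemma card_binary_words: "card (binary_words n) = 2 ^ n"
proof -
  have "binary_words n = {b. set b \<subseteq> {0, 1} \<and> length b = n}"
    by (auto simp: binary_words_def)
  then show ?thesis
    using card_lists_length_eq[of "{0, 1 :: nat}" n] by (simp add: numeral_2_eq_2)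
qed

lemma finite_binary_words: "finite (binary_words n)"
  using card_binary_words[of n] by (simp add: card_ge_0_finite)

lemma bij_betw_anti_ext:
  assumes "n > 0"
  shows "bij_betw anti_ext (binary_words n) (antiperiodic n)"
  unfolding bij_betw_def
proof
  show "inj_on anti_ext (binary_words n)"
  proof (rule inj_onI)
    fix b c assume bc: "b \<in> binary_words n" "c \<in> binary_words n" "anti_ext b = anti_ext c"
    show "b = c"
    proof (rule binary_words_eqI[OF bc(1,2)])
      fix j assume "j < n"
      then show "b ! j = 1 \<longleftrightarrow> c ! j = 1"
        using bc anti_ext_nth[of j b] anti_ext_nth[of j c] by (simp add: binary_words_def)
    qed
  qed
  show "anti_ext ` binary_words n = antiperiodic n"
  proof
    show "anti_ext ` binary_words n \<subseteq> antiperiodic n"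
      using assms by (auto simp: binary_words_def anti_ext_antiperiodic)
    show "antiperiodic n \<subseteq> anti_ext ` binary_words n"
    proof
      fix f assume f: "f \<in> antiperiodic n"
      define b where "b = map (\<lambda>j. of_bool (f (int j)) :: nat) [0..<n]"
      have b: "b \<in> binary_words n"
        by (auto simp: b_def binary_words_def)
      have "anti_ext b = f"
      proof (rule antiperiodic_eqI[OF _ f assms])
        show "anti_ext b \<in> antiperiodic n"
          using assms by (simp add: anti_ext_antiperiodic b_def)
        fix i :: int assume "0 \<le> i" "i < int n"
        then show "anti_ext b i = f i"
          using anti_ext_nth[of "nat i" b] by (simp add: b_def nat_less_iff)
      qed
      with b show "f \<in> anti_ext ` binary_words n"
        by blast
    qed
  qed
qed

section \<open>The map \<open>eta\<close> as a shift by two\<close>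

lemma eta_binary_words: "b \<in> binary_words n \<Longrightarrow> eta b \<in> binary_words n"
  by (auto simp: binary_words_def eta_def Let_def dest: in_set_takeD)

text \<open>Both sides are antiperiodic functions of \<open>i\<close>, so comparing them on
  \<open>0..n-1\<close> suffices.\<close>

lemma anti_ext_eta:
  assumes b: "b \<in> binary_words n" and "n > 0"
  shows "anti_ext (eta b) i = anti_ext b (i - 2)"
proof -
  have len: "length b = n" "length (eta b) = n"
    using b eta_binary_words[OF b] by (auto simp: binary_words_def)
  have "anti_ext (eta b) = (\<lambda>i. anti_ext b (i - 2))"
  proof (rule antiperiodic_eqI[where n = n])
    show "anti_ext (eta b) \<in> antiperiodic n"
      using len \<open>n > 0\<close> by (intro anti_ext_antiperiodic)
    have "anti_ext b (i + int n - 2) = anti_ext b ((i - 2) + int n)" for i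
      by (simp add: algebra_simps)
    then show "(\<lambda>i. anti_ext b (i - 2)) \<in> antiperiodic n"
      using anti_ext_antiperiodic[OF len(1) \<open>n > 0\<close>] by (simp add: antiperiodic_def)
    fix i :: int assume i: "0 \<le> i" "i < int n"
    show "anti_ext (eta b) i = anti_ext b (i - 2)"
    \<comment> \<open>For \<open>n = 1\<close> the map \<open>eta\<close> is the identity, and so is
      a shift by two, which is twice the antiperiod.\<close>
    proof (cases "n = 1")
      case True
      then have "anti_ext b (i - 2 + int n * 2) \<longleftrightarrow> anti_ext b (i - 2)"
        using antiperiodic_add_mult[OF anti_ext_antiperiodic[OF len(1) \<open>n > 0\<close>], of "i - 2" 2] by simp
      with True show ?thesis
        using len by (simp add: eta_def)
    next
      case False
      then have n: "n \<ge> 2"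
        using \<open>n > 0\<close> by simp
      have eta: "eta b = [1 - b ! (n - 2), 1 - b ! (n - 1)] @ take (n - 2) b"
        using len n by (simp add: eta_def)
      show ?thesis
      proof (cases "i \<ge> 2")
        case True
        define j where "j = nat (i - 2)"
        have j: "i = int (Suc (Suc j))" "Suc (Suc j) < n"
          using True i by (auto simp: j_def)
        have "anti_ext (eta b) i \<longleftrightarrow> eta b ! Suc (Suc j) = 1"
          using anti_ext_nth[of "Suc (Suc j)" "eta b"] len j by simp
        also have "eta b ! Suc (Suc j) = b ! j"
          using j by (simp add: eta)
        also have "b ! j = 1 \<longleftrightarrow> anti_ext b (i - 2)"
          using anti_ext_nth[of j b] j len by simp
        finally show ?thesis .
      next
        case False
        \<comment> \<open>Here \<open>i - 2\<close> is negative; \<open>j\<close> is its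
          representative one antiperiod later, which accounts for the complemented letter.\<close>
        define j where "j = n - 2 + nat i"
        have j: "j < n" "i - 2 = int j + int n * (-1)"
          using False i n by (auto simp: j_def)
        have "anti_ext (eta b) i \<longleftrightarrow> eta b ! nat i = 1"
          using anti_ext_nth[of "nat i" "eta b"] len i by (simp add: nat_less_iff)
        also have "eta b ! nat i = 1 - b ! j"
        proof -
          have "i = 0 \<or> i = 1" using False i by auto
          then show ?thesis
            using n by (auto simp: eta j_def Suc_diff_le numeral_2_eq_2)
        qed
        also have "1 - b ! j = 1 \<longleftrightarrow> \<not> anti_ext b (int j)"
          using binary_words_nth[OF b j(1)] anti_ext_nth[of j b] len j by auto
        also have "\<dots> \<longleftrightarrow> anti_ext b (i - 2)"
          unfolding j(2) antiperiodic_add_mult[OF anti_ext_antiperiodic[OF len(1) \<open>n > 0\<close>]] by simp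
        finally show ?thesis .
      qed
    qed
  qed fact
  then show ?thesis
    by (simp add: fun_eq_iff)
qed

lemma eta_funpow_binary_words: "b \<in> binary_words n \<Longrightarrow> (eta ^^ k) b \<in> binary_words n"
  by (induction k) (simp_all add: eta_binary_words)

lemma anti_ext_eta_funpow:
  assumes "b \<in> binary_words n" "n > 0"
  shows "anti_ext ((eta ^^ k) b) i = anti_ext b (i - 2 * int k)"
proof (induction k arbitrary: i)
  case (Suc k)
  have "anti_ext ((eta ^^ Suc k) b) i = anti_ext ((eta ^^ k) b) (i - 2)"
    using anti_ext_eta[OF eta_funpow_binary_words[OF assms(1)] assms(2)] by simp
  then show ?case
    using Suc by (simp add: algebra_simps)
qed simp

lemma eta_funpow_fixed_iff:
  assumes "b \<in> binary_words n" "n > 0"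
  shows "(eta ^^ k) b = b \<longleftrightarrow> (\<forall>i. anti_ext b (i + 2 * int k) = anti_ext b i)"
proof -
  have "(eta ^^ k) b = b \<longleftrightarrow> anti_ext ((eta ^^ k) b) = anti_ext b"
    using bij_betw_anti_ext[OF assms(2)] eta_funpow_binary_words[OF assms(1)] assms(1)
    by (auto simp: bij_betw_def inj_on_def)
  also have "\<dots> \<longleftrightarrow> (\<forall>i. anti_ext b (i - 2 * int k) = anti_ext b i)"
    by (simp add: fun_eq_iff anti_ext_eta_funpow[OF assms])
  also have "\<dots> \<longleftrightarrow> (\<forall>i. anti_ext b (i + 2 * int k) = anti_ext b i)"
  proof (rule iffI; rule allI)
    fix i
    assume "\<forall>i. anti_ext b (i - 2 * int k) = anti_ext b i"
    from this[rule_format, of "i + 2 * int k"] show "anti_ext b (i + 2 * int k) = anti_ext b i" by simp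
  next
    fix i
    assume "\<forall>i. anti_ext b (i + 2 * int k) = anti_ext b i"
    from this[rule_format, of "i - 2 * int k"] show "anti_ext b (i - 2 * int k) = anti_ext b i" by simp
  qed
  finally show ?thesis .
qed

lemma eta_funpow_id:
  assumes "b \<in> binary_words n" "n > 0"
  shows "(eta ^^ n) b = b"
proof -
  have "anti_ext b \<in> antiperiodic n"
    using assms by (auto simp: binary_words_def anti_ext_antiperiodic)
  then have "anti_ext b (i + 2 * int n) = anti_ext b i" for i
    using antiperiodic_add_mult[of "anti_ext b" n i 2] by (simp add: mult.commute)
  then show ?thesis
    by (simp add: eta_funpow_fixed_iff[OF assms])
qed

section \<open>Fixed points of powers of the shift\<close>

lemma period_mult:
  fixes f :: "int \<Rightarrow> 'a"
  assumes "\<And>i. f (i + p) = f i"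
  shows "f (i + p * j) = f i"
proof (induction j rule: int_induct[where k = 0])
  case (step1 j)
  then show ?case
    using assms[of "i + p * j"] by (simp add: algebra_simps)
next
  case (step2 j)
  then show ?case
    using assms[of "i + p * (j - 1)"] by (simp add: algebra_simps)
qed simp

text \<open>Periods form a subgroup of the integers, so Bezout's identity applies.\<close>

lemma period_gcd:
  fixes f :: "int \<Rightarrow> 'a"
  assumes "\<And>i. f (i + p) = f i" "\<And>i. f (i + q) = f i"
  shows "f (i + gcd p q) = f i"
proof -
  obtain u v where "p * u + q * v = gcd p q"
    using bezout_int[of p q] by (metis mult.commute)
  then have "f (i + gcd p q) = f (i + p * u + q * v)"
    by (simp add: add.assoc)
  also have "\<dots> = f i"
    by (simp add: period_mult[of f q] period_mult[of f p] assms)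
  finally show ?thesis .
qed

text \<open>
  The periods \<open>2 n\<close> and \<open>2 k\<close> combine to the period \<open>2 m\<close>; the antiperiod \<open>n\<close> is a multiple of
  it if \<open>n / m\<close> is even, and congruent to \<open>m\<close> modulo it otherwise.
\<close>

lemma antiperiodic_shift_invariant:
  assumes "n > 0" and m: "m = gcd n k"
  shows "{f \<in> antiperiodic n. \<forall>i. f (i + 2 * int k) = f i}
    = (if even (n div m) then {} else antiperiodic m)"
proof -
  have "m > 0"
    using assms by simp
  obtain d where d: "n = m * d"
    using m by (meson dvdE gcd_dvd1)
  obtain k' where k': "k = m * k'"
    using m by (meson dvdE gcd_dvd2)
  have nm: "n div m = d"
    using d \<open>m > 0\<close> by simp
  have per: "f (i + 2 * int m * j) = f i"
    if f: "f \<in> antiperiodic n" and fk: "\<And>i. f (i + 2 * int k) = f i" for f i j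
  proof -
    have "f (i + 2 * int n) = f i" for i
      using antiperiodic_add_mult[OF f, of i 2] by (simp add: mult.commute)
    then have "f (i + gcd (2 * int n) (2 * int k)) = f i" for i
      using fk by (intro period_gcd)
    moreover have "gcd (2 * int n) (2 * int k) = 2 * int m"
      using m by (simp flip: gcd_mult_distrib_int)
    ultimately have "f (i + 2 * int m) = f i" for i
      by metis
    then show ?thesis
      by (rule period_mult)
  qed
  show ?thesis
  proof (cases "even d")
    case True
    then obtain e where e: "d = 2 * e" by auto
    have False if f: "f \<in> antiperiodic n" and fk: "\<forall>i. f (i + 2 * int k) = f i" for f
    proof -
      have "f (0 + 2 * int m * int e) = f 0"
        using fk by (intro per f) simp
      moreover have "f (0 + int n) = (\<not> f 0)"
        using f by (simp only: antiperiodic_def mem_Collect_eq)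
      ultimately show False
        using d e by (simp add: mult_ac)
    qed
    then show ?thesis
      using nm True by auto
  next
    case False
    then obtain e where e: "d = 2 * e + 1"
      using oddE by blast
    have "f \<in> antiperiodic m" if f: "f \<in> antiperiodic n" and fk: "\<forall>i. f (i + 2 * int k) = f i" for f
    proof -
      have "f (i + int m) \<longleftrightarrow> \<not> f i" for i
      proof -
        have "f (i + int n) \<longleftrightarrow> \<not> f i"
          using f by (simp add: antiperiodic_def)
        moreover have "i + int n = (i + int m) + 2 * int m * int e"
          using d e by (simp add: algebra_simps)
        moreover have "f ((i + int m) + 2 * int m * int e) = f (i + int m)"
          using fk by (intro per f) simp
        ultimately show ?thesis by simp
      qed
      then show ?thesis by (simp add: antiperiodic_def)
    qed
    \<comment> \<open>Conversely, \<open>n\<close> is an odd multiple of the antiperiod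
      \<open>m\<close>, and \<open>2 * k\<close> an even one.\<close>
    moreover have "f \<in> antiperiodic n" "f (i + 2 * int k) = f i" if f: "f \<in> antiperiodic m" for f i
      using antiperiodic_add_mult[OF f, of _ "int d"] antiperiodic_add_mult[OF f, of i "2 * int k'"] False
      by (simp_all add: antiperiodic_def d k' mult_ac)
    ultimately show ?thesis
      using nm False by auto
  qed
qed

text \<open>The size of a symmetric difference is additive modulo 2.\<close>

lemma odd_card_neq_iff:
  "odd (card {j. j < n \<and> P j \<noteq> Q j}) \<longleftrightarrow> odd (card {j. j < n \<and> P j}) \<noteq> odd (card {j::nat. j < n \<and> Q j})"
proof (induction n)
  case (Suc n)
  have "card {j. j < Suc n \<and> R j} = of_bool (R n) + card {j. j < n \<and> R j}" for R :: "nat \<Rightarrow> bool"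
  proof -
    have "{j. j < Suc n \<and> R j} = (if R n then insert n {j. j < n \<and> R j} else {j. j < n \<and> R j})"
      by (auto simp: less_Suc_eq)
    then show ?thesis by simp
  qed
  then show ?case
    using Suc by auto
qed simp

text \<open>
  Flipping the letters at all multiples of \<open>m\<close> changes an odd number of the first \<open>m d\<close> letters,
  so exactly half of the antiperiodic functions have an odd number of ones there.
\<close>

lemma card_antiperiodic_odd:
  assumes "m > 0" "odd d"
  shows "card {f \<in> antiperiodic m. odd (card {j. j < m * d \<and> f (int j)})} = 2 ^ (m - 1)"
proof -
  let ?p = "\<lambda>f. odd (card {j. j < m * d \<and> f (int j)})"
  let ?O = "{f \<in> antiperiodic m. ?p f}" and ?E = "{f \<in> antiperiodic m. \<not> ?p f}"
  \<comment> \<open>The set of flipped positions is invariant under translation by \<open>m\<close>,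
    so \<open>T\<close> preserves antiperiodicity; it is its own inverse.\<close>
  define T :: "(int \<Rightarrow> bool) \<Rightarrow> int \<Rightarrow> bool" where "T f = (\<lambda>i. f i \<noteq> (int m dvd i))" for f
  have TT: "T (T f) = f" for f
    by (auto simp: T_def)
  have TA: "T f \<in> antiperiodic m" if "f \<in> antiperiodic m" for f
    using that by (simp add: antiperiodic_def T_def)
  have "{j. j < m * d \<and> m dvd j} = (\<lambda>j. m * j) ` {..<d}"
    using assms(1) by (auto elim!: dvdE)
  then have "card {j. j < m * d \<and> m dvd j} = d"
    using assms(1) by (simp add: card_image inj_on_def)
  then have Tp: "?p (T f) \<longleftrightarrow> \<not> ?p f" for f
    using odd_card_neq_iff[of "m * d" "\<lambda>j. f (int j)" "\<lambda>j. m dvd j"] assms(2) by (simp add: T_def)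
  have "bij_betw T ?O ?E"
    by (rule bij_betw_byWitness[where f' = T]) (use TT TA Tp in auto)
  then have eq: "card ?O = card ?E"
    by (rule bij_betw_same_card)
  have card: "card (antiperiodic m) = 2 ^ m"
    using bij_betw_same_card[OF bij_betw_anti_ext[OF assms(1)]] card_binary_words by simp
  then have "finite (antiperiodic m)"
    by (simp add: card_ge_0_finite)
  then have "card (?O \<union> ?E) = card ?O + card ?E"
    by (intro card_Un_disjoint) auto
  moreover have "?O \<union> ?E = antiperiodic m"
    by auto
  ultimately have "2 * card ?O = 2 ^ m"
    using eq card by simp
  also have "(2 :: nat) ^ m = 2 * 2 ^ (m - 1)"
    using assms(1) by (simp flip: power_Suc)
  finally show ?thesis
    by (simp only: mult_left_cancel)
qed

lemma count_list_anti_ext: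
  "count_list b 1 = card {j. j < length b \<and> anti_ext b (int j)}"
proof -
  have "count_list b 1 = card {j. j < length b \<and> b ! j = 1}"
    unfolding count_list_eq_length_filter length_filter_conv_card
    by (rule arg_cong[where f = card]) auto
  also have "{j. j < length b \<and> b ! j = 1} = {j. j < length b \<and> anti_ext b (int j)}"
    using anti_ext_nth by blast
  finally show ?thesis .
qed

text \<open>Under \<open>anti_ext\<close> the fixed words become the shift-invariant functions
  classified above, and oddness is tested on the first \<open>n = m * (n div m)\<close> letters, the
  window used in \<open>card_antiperiodic_odd\<close>.\<close>

lemma card_eta_funpow_fixed:
  assumes "n > 0" and m: "m = gcd n k"
  shows "card {b \<in> OBW n. (eta ^^ k) b = b} = (if even (n div m) then 0 else 2 ^ (m - 1))"
proof -
  let ?F = "{f \<in> {f \<in> antiperiodic n. \<forall>i. f (i + 2 * int k) = f i}. odd (card {j. j < n \<and> f (int j)})}"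
  have "bij_betw anti_ext {b \<in> OBW n. (eta ^^ k) b = b} ?F"
    unfolding bij_betw_def
  proof
    have sub: "{b \<in> OBW n. (eta ^^ k) b = b} \<subseteq> binary_words n"
      by (auto simp: OBW_def)
    show "inj_on anti_ext {b \<in> OBW n. (eta ^^ k) b = b}"
      using bij_betw_anti_ext[OF assms(1)] sub by (auto simp: bij_betw_def intro: inj_on_subset)
    have iff: "b \<in> OBW n \<and> (eta ^^ k) b = b \<longleftrightarrow> anti_ext b \<in> ?F" if "b \<in> binary_words n" for b
    proof -
      have "anti_ext b \<in> antiperiodic n" "length b = n"
        using that assms(1) by (auto simp: binary_words_def anti_ext_antiperiodic)
      then show ?thesis
        using that count_list_anti_ext[of b]
        by (simp add: OBW_def eta_funpow_fixed_iff[OF that assms(1)] conj_commute)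
    qed
    have surj: "anti_ext ` binary_words n = antiperiodic n"
      using bij_betw_anti_ext[OF assms(1)] by (simp add: bij_betw_def)
    show "anti_ext ` {b \<in> OBW n. (eta ^^ k) b = b} = ?F"
    proof (intro equalityI subsetI)
      fix f assume "f \<in> anti_ext ` {b \<in> OBW n. (eta ^^ k) b = b}"
      then obtain b where b: "b \<in> OBW n \<and> (eta ^^ k) b = b" "f = anti_ext b"
        by blast
      then show "f \<in> ?F"
        using iff[of b] sub by (simp only: b(2)) blast
    next
      fix f assume f: "f \<in> ?F"
      then have "f \<in> anti_ext ` binary_words n"
        using surj by simp
      then obtain b where b: "b \<in> binary_words n" "f = anti_ext b"
        by blast
      then have "b \<in> OBW n \<and> (eta ^^ k) b = b"
        using iff f by simp
      then show "f \<in> anti_ext ` {b \<in> OBW n. (eta ^^ k) b = b}"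
        using b(2) by simp
    qed
  qed
  then have "card {b \<in> OBW n. (eta ^^ k) b = b} = card ?F"
    by (rule bij_betw_same_card)
  also have "\<dots> = (if even (n div m) then 0 else 2 ^ (m - 1))"
  proof (cases "even (n div m)")
    case True
    then show ?thesis
      by (simp add: antiperiodic_shift_invariant[OF assms])
  next
    case False
    moreover have "m > 0" "m * (n div m) = n"
      using assms by auto
    ultimately show ?thesis
      using card_antiperiodic_odd[of m "n div m"]
      by (simp add: antiperiodic_shift_invariant[OF assms])
  qed
  finally show ?thesis .
qed

text \<open>Complementing exactly two letters preserves the parity of the number of ones.\<close>

lemma eta_OBW: "eta \<in> OBW n \<rightarrow> OBW n"
proof
  fix b assume b: "b \<in> OBW n"
  show "eta b \<in> OBW n"
  proof (cases "n \<le> 1")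
    case True
    with b show ?thesis
      by (auto simp: OBW_def binary_words_def eta_def)
  next
    case False
    have bw: "b \<in> binary_words n" "length b = n"
      using b by (auto simp: OBW_def binary_words_def)
    obtain N where N: "n = Suc (Suc N)"
      using False by (metis One_nat_def Suc_le_mono le0 not0_implies_Suc)
    have "b = take (n - 2) b @ [b ! (n - 2), b ! (n - 1)]"
      using take_Suc_conv_app_nth[of N b] take_Suc_conv_app_nth[of "Suc N" b] bw N by simp
    then have "count_list b 1 = count_list (take (n - 2) b) 1 + count_list [b ! (n - 2), b ! (n - 1)] 1"
      by (metis count_list_append)
    moreover have "count_list (eta b) 1
        = count_list [1 - b ! (n - 2), 1 - b ! (n - 1)] 1 + count_list (take (n - 2) b) 1"
      using False bw by (simp add: eta_def)
    moreover have "b ! (n - 2) = 0 \<or> b ! (n - 2) = 1" "b ! (n - 1) = 0 \<or> b ! (n - 1) = 1"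
      using False binary_words_nth[OF bw(1)] by auto
    ultimately have "odd (count_list (eta b) 1) = odd (count_list b 1)"
      by auto
    then show ?thesis
      using b eta_binary_words by (simp add: OBW_def)
  qed
qed

section \<open>The words in \<open>CMP n\<close>\<close>

text \<open>The task is to find the starting point. With \<open>h\<close> the number of east steps
  minus that of north steps, the path has \<open>x - y = x0 + h\<close>, which must avoid 0 and
  \<open>n + 2\<close>. As \<open>h\<close> varies by at most \<open>n\<close>, starting at one
  minus its minimum keeps this difference in \<open>1..n+1\<close>.\<close>

lemma CMP_word_in_CMP:
  assumes "w \<in> binary_words N"
  defines "u \<equiv> w @ [0]" and "n \<equiv> Suc N"
  shows "u @ map (\<lambda>c. 1 - c) u \<in> CMP n"
proof -
  define b where "b = u @ map (\<lambda>c. 1 - c) u"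
  have u: "length u = n" "set u \<subseteq> {0, 1}" "u ! (n - 1) = 0"
    using assms(1) by (auto simp: binary_words_def u_def n_def nth_append)
  have b: "length b = 2 * n" "set b \<subseteq> {0, 1}"
    using u by (auto simp: b_def)
  have compl: "count_list (map (\<lambda>c. 1 - c) v) 0 = count_list v 1
      \<and> count_list (map (\<lambda>c. 1 - c) v) 1 = count_list v 0
      \<and> count_list v 0 + count_list v 1 = length v" if "set v \<subseteq> {0, 1}" for v :: "nat list"
    using that by (induction v) auto
  have counts: "count_list b 0 = n" "count_list b 1 = n"
    using compl[OF u(2)] u(1) by (simp_all add: b_def)
  have bnth: "b ! i = u ! i" "b ! (n + i) = 1 - u ! i" if "i < n" for i
    using that u by (simp_all add: b_def nth_append)

  define h where "h i = int (count_list (take i b) 0) - int (count_list (take i b) 1)" for i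
  have hSuc: "h (Suc i) = h i + (if b ! i = 0 then 1 else -1)" if "i < 2 * n" for i
  proof -
    have "b ! i = 0 \<or> b ! i = 1"
      using that b by (intro binary_words_nth[of b "2 * n"]) (auto simp: binary_words_def)
    then show ?thesis
      using that b by (auto simp: h_def take_Suc_conv_app_nth)
  qed
  have h_lip: "\<bar>h j - h i\<bar> \<le> int (j - i)" if "i \<le> j" "j \<le> 2 * n" for i j
    using that
  proof (induction j rule: dec_induct)
    case (step j)
    then show ?case
      using hSuc[of j] by (auto simp: Suc_diff_le split: if_splits)
  qed simp
  have h0: "h 0 = 0" "h (2 * n) = 0"
    using b counts by (simp_all add: h_def)
  \<comment> \<open>the heights close up after \<open>2 n\<close> steps, and two points of a cycle of length \<open>2 n\<close> have distance at most \<open>n\<close>\<close>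
  have h_osc': "\<bar>h j - h i\<bar> \<le> int n" if "i \<le> j" "j \<le> 2 * n" for i j
  proof (cases "j - i \<le> n")
    case True
    then show ?thesis
      using h_lip[OF that] by linarith
  next
    case False
    have "\<bar>h i\<bar> \<le> int i" "\<bar>h j\<bar> \<le> int (2 * n - j)"
      using that h_lip[of 0 i] h_lip[of j "2 * n"] h0 by auto
    moreover have "int i + int (2 * n - j) \<le> int n"
      using False that by linarith
    ultimately show ?thesis
      by linarith
  qed
  have h_osc: "h j - h i \<le> int n" if "i \<le> 2 * n" "j \<le> 2 * n" for i j
    using h_osc'[of i j] h_osc'[of j i] that by (cases "i \<le> j") auto
  define x where "x = Min (h ` {0..2 * n})"
  have x_le: "x \<le> h i" if "i \<le> 2 * n" for i
    using that by (simp add: x_def)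
  have "x \<in> h ` {0..2 * n}"
    unfolding x_def by (rule Min_in) auto
  then obtain j where j: "j \<le> 2 * n" "x = h j"
    by auto
  \<comment> \<open>This guarantees \<open>x0 \<le> n\<close>. A minimum of \<open>-n\<close> could
    be reached only after \<open>n\<close> north steps, but step \<open>n\<close> goes east because
    \<open>u\<close> ends in 0.\<close>
  have "x \<noteq> - int n"
  proof
    assume "x = - int n"
    then have "j = n"
      using j h0 h_lip[of 0 j] h_lip[of j "2 * n"] by linarith
    then have "h (n - 1) = - int n - 1"
      using hSuc[of "n - 1"] bnth(1)[of "n - 1"] u j \<open>x = - int n\<close> by (simp add: n_def)
    then show False
      using h_lip[of 0 "n - 1"] h0 by (simp add: n_def)
  qed
  then have x: "- int n < x" "x \<le> 0"
    using h_osc[of j 0] j x_le[of 0] h0 by auto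
  define x0 where "x0 = nat (1 - x)"
  have x0: "int x0 = 1 - x" "x0 \<in> {1..n}"
    using x by (auto simp: x0_def)
  have "case path_point x0 b i of (x, y) \<Rightarrow> y \<noteq> x \<and> y \<noteq> x - (int n + 2)" if "i \<in> {0..2 * n}" for i
    using that x0(1) x_le[of i] h_osc[of j i] j by (auto simp: path_point_def h_def)
  moreover have "b ! (i - 1) = 1 - b ! (n + i - 1)" if "i \<in> {1..n}" for i
  proof -
    have "u ! (i - 1) = 0 \<or> u ! (i - 1) = 1"
      using that u by (intro binary_words_nth[of u n]) (auto simp: binary_words_def)
    then show ?thesis
      using that bnth[of "i - 1"] by auto
  qed
  moreover have "b ! (2 * n - 1) = 1"
    using bnth(2)[of "n - 1"] u by (simp add: n_def mult_2)
  ultimately have "(x0, b) \<in> CMP_pairs n"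
    using b counts x0 by (auto simp: CMP_pairs_def binary_words_def)
  then show ?thesis
    unfolding CMP_def b_def by force
qed

text \<open>The last letter and the complementation rule determine a word from its first
  \<open>n - 1\<close> letters; conversely, \<open>CMP_word_in_CMP\<close> provides a starting point
  for each choice of these.\<close>

lemma CMP_eq:
  assumes "n \<ge> 1"
  shows "CMP n = (\<lambda>w. (w @ [0]) @ map (\<lambda>c. 1 - c) (w @ [0])) ` binary_words (n - 1)"
proof
  show "(\<lambda>w. (w @ [0]) @ map (\<lambda>c. 1 - c) (w @ [0])) ` binary_words (n - 1) \<subseteq> CMP n"
  proof
    fix b assume "b \<in> (\<lambda>w. (w @ [0]) @ map (\<lambda>c. 1 - c) (w @ [0])) ` binary_words (n - 1)"
    then obtain w where "w \<in> binary_words (n - 1)" "b = (w @ [0]) @ map (\<lambda>c. 1 - c) (w @ [0])"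
      by blast
    then show "b \<in> CMP n"
      using CMP_word_in_CMP[of w "n - 1"] assms by simp
  qed
  show "CMP n \<subseteq> (\<lambda>w. (w @ [0]) @ map (\<lambda>c. 1 - c) (w @ [0])) ` binary_words (n - 1)"
  proof
    fix b assume "b \<in> CMP n"
    then have b: "b \<in> binary_words (2 * n)" "b ! (2 * n - 1) = 1"
      and anti: "\<And>i. i \<in> {1..n} \<Longrightarrow> b ! (i - 1) = 1 - b ! (n + i - 1)"
      by (auto simp: CMP_def CMP_pairs_def)
    have len: "length b = 2 * n"
      using b by (simp add: binary_words_def)
    have second: "b ! (n + i) = 1 - b ! i" if "i < n" for i
      using anti[of "Suc i"] binary_words_nth[OF b(1), of "n + i"] that by auto
    define w where "w = take (n - 1) b"
    have "b ! (n - 1) = 0"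
      using anti[of n] b assms by (simp add: mult_2)
    then have u: "w @ [0] = take n b"
      using assms len take_Suc_conv_app_nth[of "n - 1" b] by (simp add: w_def)
    have "b = take n b @ map (\<lambda>c. 1 - c) (take n b)"
    proof (rule nth_equalityI)
      fix i assume i: "i < length b"
      show "b ! i = (take n b @ map (\<lambda>c. 1 - c) (take n b)) ! i"
        using i len second[of "i - n"] by (auto simp: nth_append)
    qed (simp add: len)
    then have "b = (w @ [0]) @ map (\<lambda>c. 1 - c) (w @ [0])"
      by (simp only: u)
    moreover have "w \<in> binary_words (n - 1)"
      using b len by (auto simp: w_def binary_words_def dest: in_set_takeD)
    ultimately show "b \<in> (\<lambda>w. (w @ [0]) @ map (\<lambda>c. 1 - c) (w @ [0])) ` binary_words (n - 1)"
      by blast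
  qed
qed

lemma inj_CMP_word: "inj (\<lambda>w. (w @ [0]) @ map (\<lambda>c. 1 - c) (w @ [0 :: nat]))"
proof (rule injI)
  fix v w :: "nat list"
  assume eq: "(v @ [0]) @ map (\<lambda>c. 1 - c) (v @ [0]) = (w @ [0]) @ map (\<lambda>c. 1 - c) (w @ [0])"
  then have "length v = length w"
    by (auto dest: arg_cong[where f = length])
  then show "v = w"
    using eq by simp
qed

text \<open>\<open>M_map\<close> forgets the last letter and then applies the parametrization of
  \<open>CMP n\<close>. Forgetting is invertible on \<open>OBW n\<close> since odd parity forces the
  lost letter, which \<open>?p\<close> restores.\<close>

lemma bij_betw_M_map:
  assumes "n \<ge> 1"
  shows "bij_betw M_map (OBW n) (CMP n)"
proof -
  let ?\<Phi> = "\<lambda>w. (w @ [0]) @ map (\<lambda>c. 1 - c) (w @ [0 :: nat])"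
  let ?p = "\<lambda>w. w @ [if even (count_list w 1) then 1 else 0 :: nat]"
  obtain N where n: "n = Suc N"
    using assms by (cases n) auto
  have "bij_betw butlast (OBW n) (binary_words (n - 1))"
  proof (rule bij_betw_byWitness[where f' = ?p])
    show "\<forall>b\<in>OBW n. ?p (butlast b) = b"
    proof
      fix b assume b: "b \<in> OBW n"
      then obtain w a where wa: "b = w @ [a]"
        by (cases b rule: rev_cases) (auto simp: OBW_def binary_words_def n)
      then show "?p (butlast b) = b"
        using b by (auto simp: OBW_def binary_words_def)
    qed
    show "butlast ` OBW n \<subseteq> binary_words (n - 1)"
      by (auto simp: OBW_def binary_words_def dest: in_set_butlastD)
    show "?p ` binary_words (n - 1) \<subseteq> OBW n"
      unfolding OBW_def binary_words_def n by (auto split: if_splits)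
  qed simp
  moreover have "bij_betw ?\<Phi> (binary_words (n - 1)) (CMP n)"
    using CMP_eq[OF assms] inj_CMP_word by (simp only: bij_betw_def) (auto intro: inj_on_subset)
  ultimately have "bij_betw (?\<Phi> \<circ> butlast) (OBW n) (CMP n)"
    by (rule bij_betw_trans)
  moreover have "?\<Phi> \<circ> butlast = M_map"
    by (auto simp: M_map_def)
  ultimately show ?thesis
    by simp
qed

section \<open>The major index\<close>

definition change_sum :: "nat list \<Rightarrow> nat" where
  "change_sum u = (\<Sum>i\<in>{1..<length u}. if u ! (i - 1) \<noteq> u ! i then i else 0)"

lemma maj_conv_sum: "maj b = (\<Sum>i\<in>{1..<length b}. if b ! (i - 1) > b ! i then i else 0)"
  unfolding maj_def by (subst sum.inter_filter) simp_all

text \<open>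
  Since descents of the complement are ascents, a position \<open>i\<close> where \<open>u\<close> changes contributes to the
  major index either \<open>i\<close> or \<open>n + i\<close>.
\<close>

lemma maj_CMP_word:
  assumes "w \<in> binary_words N"
  defines "u \<equiv> w @ [0]" and "n \<equiv> Suc N"
  shows "\<exists>a. maj (u @ map (\<lambda>c. 1 - c) u) = change_sum u + n * a"
proof -
  define b where "b = u @ map (\<lambda>c. 1 - c) u"
  define A where "A = {i \<in> {1..<n}. u ! (i - 1) < u ! i}"
  have u: "length u = n" "set u \<subseteq> {0, 1}" "u ! (n - 1) = 0"
    using assms(1) by (auto simp: binary_words_def u_def n_def nth_append)
  have bin: "u ! i = 0 \<or> u ! i = 1" if "i < n" for i
    using that u by (intro binary_words_nth[of u n]) (auto simp: binary_words_def)
  have bnth: "b ! i = u ! i" "b ! (n + i) = 1 - u ! i" if "i < n" for i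
    using that u by (simp_all add: b_def nth_append)
  let ?f = "\<lambda>i. if b ! (i - 1) > b ! i then i else 0"
  have ivl: "{1..<2 * n} = {1..<n} \<union> insert n ((\<lambda>i. i + n) ` {1..<n})"
  proof -
    have "(\<lambda>i. i + n) ` {1..<n} = {1 + n..<n + n}"
      by (rule image_add_atLeastLessThan')
    then show ?thesis
      by (auto simp: n_def)
  qed
  have "maj b = (\<Sum>i\<in>{1..<2 * n}. ?f i)"
    using u by (simp add: maj_conv_sum b_def mult_2)
  also have "\<dots> = (\<Sum>i\<in>{1..<n}. ?f i) + (?f n + (\<Sum>i\<in>(\<lambda>i. i + n) ` {1..<n}. ?f i))"
    unfolding ivl by (subst sum.union_disjoint) (auto simp: sum.insert)
  \<comment> \<open>There is no descent at the junction of the two halves, since \<open>u\<close>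
    ends in 0.\<close>
  also have "?f n = 0"
    using bnth(1)[of "n - 1"] u by (simp add: n_def)
  also have "(\<Sum>i\<in>(\<lambda>i. i + n) ` {1..<n}. ?f i) = (\<Sum>i\<in>{1..<n}. ?f (i + n))"
    by (subst sum.reindex) (auto simp: inj_on_def)
  also have "\<dots> = (\<Sum>i\<in>{1..<n}. if u ! (i - 1) < u ! i then i + n else 0)"
  proof (rule sum.cong)
    fix i assume i: "i \<in> {1..<n}"
    then have "b ! (i + n) = 1 - u ! i" "b ! (i + n - 1) = 1 - u ! (i - 1)"
      using bnth(2)[of i] bnth(2)[of "i - 1"] by (auto simp: add.commute)
    then show "?f (i + n) = (if u ! (i - 1) < u ! i then i + n else 0)"
      using i bin[of i] bin[of "i - 1"] by auto
  qed simp
  also have "(\<Sum>i\<in>{1..<n}. ?f i) = (\<Sum>i\<in>{1..<n}. if u ! (i - 1) > u ! i then i else 0)"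
    using bnth(1) by (intro sum.cong) auto
  finally have "maj b = (\<Sum>i\<in>{1..<n}. (if u ! (i - 1) > u ! i then i else 0)
      + (if u ! (i - 1) < u ! i then i + n else 0))"
    by (simp add: sum.distrib)
  also have "\<dots> = (\<Sum>i\<in>{1..<n}. (if u ! (i - 1) \<noteq> u ! i then i else 0)
      + (if u ! (i - 1) < u ! i then n else 0))"
    by (intro sum.cong) auto
  also have "\<dots> = change_sum u + n * card A"
    by (simp add: sum.distrib change_sum_def u A_def sum.inter_filter[symmetric] mult.commute)
  finally show ?thesis
    by (auto simp: b_def)
qed

lemma change_sum_snoc:
  "change_sum (w @ [a, c]) = change_sum (w @ [a]) + (if a \<noteq> c then Suc (length w) else 0)"
proof -
  have "{1..<length (w @ [a, c])} = insert (Suc (length w)) {1..<length (w @ [a])}"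
    by auto
  moreover have "(\<Sum>i\<in>{1..<length (w @ [a])}. if (w @ [a, c]) ! (i - 1) \<noteq> (w @ [a, c]) ! i then i else 0)
      = change_sum (w @ [a])"
    unfolding change_sum_def by (intro sum.cong) (auto simp: nth_append less_Suc_eq)
  ultimately show ?thesis
    unfolding change_sum_def[of "w @ [a, c]"] by (simp add: nth_append)
qed

lemma binary_words_Suc: "binary_words (Suc N) = (\<lambda>(w, a). w @ [a]) ` (binary_words N \<times> {0, 1})"
proof safe
  fix b assume "b \<in> binary_words (Suc N)"
  then show "b \<in> (\<lambda>(w, a). w @ [a]) ` (binary_words N \<times> {0, 1})"
    by (cases b rule: rev_cases) (auto simp: binary_words_def)
qed (auto simp: binary_words_def)

text \<open>Once the last letter is fixed, a word corresponds to the set of its change positions, an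
  arbitrary subset of \<open>{1..N}\<close>; the sum is the expanded product. The induction peels
  off the letter before \<open>c\<close>, hence the statement for both values of
  \<open>c\<close>.\<close>

lemma sum_power_change_sum:
  fixes z :: "'a::comm_semiring_1"
  assumes "c \<in> {0, 1}"
  shows "(\<Sum>w\<in>binary_words N. z ^ change_sum (w @ [c])) = (\<Prod>i\<in>{1..<Suc N}. 1 + z ^ i)"
  using assms
proof (induction N arbitrary: c)
  case 0
  then show ?case
  proof -
    have "binary_words 0 = {[]}"
      by (auto simp: binary_words_def)
    then show ?thesis
      by (simp add: change_sum_def)
  qed
next
  case (Suc N)
  let ?P = "\<Prod>i\<in>{1..<Suc N}. 1 + z ^ i"
  have "(\<Sum>w\<in>binary_words (Suc N). z ^ change_sum (w @ [c]))
      = (\<Sum>(w, a)\<in>binary_words N \<times> {0, 1}. z ^ change_sum (w @ [a, c]))"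
    unfolding binary_words_Suc by (subst sum.reindex) (auto simp: inj_on_def intro!: sum.cong)
  also have "\<dots> = (\<Sum>w\<in>binary_words N. \<Sum>a\<in>{0, 1}. z ^ change_sum (w @ [a, c]))"
    by (rule sum.cartesian_product[symmetric])
  also have "\<dots> = (\<Sum>a\<in>{0, 1}. \<Sum>w\<in>binary_words N. z ^ change_sum (w @ [a, c]))"
    by (rule sum.swap)
  \<comment> \<open>Exactly one of the two values of \<open>a\<close> creates a change, at position
    \<open>Suc N\<close>.\<close>
  also have "\<dots> = (\<Sum>a\<in>{0, 1}. ?P * (if a \<noteq> c then z ^ Suc N else 1))"
  proof (rule sum.cong)
    fix a :: nat assume a: "a \<in> {0, 1}"
    have "(\<Sum>w\<in>binary_words N. z ^ change_sum (w @ [a, c]))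
        = (\<Sum>w\<in>binary_words N. z ^ change_sum (w @ [a]) * (if a \<noteq> c then z ^ Suc N else 1))"
      by (rule sum.cong) (auto simp: change_sum_snoc power_add binary_words_def)
    then show "(\<Sum>w\<in>binary_words N. z ^ change_sum (w @ [a, c])) = ?P * (if a \<noteq> c then z ^ Suc N else 1)"
      using Suc.IH[OF a] by (simp only: sum_distrib_right[symmetric])
  qed simp
  also have "\<dots> = ?P * (1 + z ^ Suc N)"
    using Suc.prems by (auto simp: algebra_simps)
  finally show ?case
    by simp
qed

lemma sum_power_maj_CMP:
  fixes z :: "'a::comm_semiring_1"
  assumes "n \<ge> 1" "z ^ n = 1"
  shows "(\<Sum>b\<in>CMP n. z ^ maj b) = (\<Prod>i\<in>{1..<n}. 1 + z ^ i)"
proof -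
  let ?\<Phi> = "\<lambda>w. (w @ [0]) @ map (\<lambda>c. 1 - c) (w @ [0 :: nat])"
  obtain N where n: "n = Suc N"
    using assms by (cases n) auto
  have "(\<Sum>b\<in>CMP n. z ^ maj b) = (\<Sum>w\<in>binary_words N. z ^ maj (?\<Phi> w))"
    unfolding CMP_eq[OF assms(1)] using inj_CMP_word
    by (subst sum.reindex) (auto simp: n intro: inj_on_subset)
  also have "\<dots> = (\<Sum>w\<in>binary_words N. z ^ change_sum (w @ [0]))"
  proof (rule sum.cong)
    fix w assume "w \<in> binary_words N"
    then obtain a where "maj (?\<Phi> w) = change_sum (w @ [0]) + n * a"
      using maj_CMP_word[of w N] n by auto
    then show "z ^ maj (?\<Phi> w) = z ^ change_sum (w @ [0])"
      using assms(2) by (simp only: power_add power_mult) simp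
  qed simp
  also have "\<dots> = (\<Prod>i\<in>{1..<n}. 1 + z ^ i)"
    unfolding n by (rule sum_power_change_sum) simp
  finally show ?thesis .
qed

section \<open>Cyclic sieving\<close>

lemma BijGroup_pow:
  assumes "g \<in> Bij X"
  shows "g [^]\<^bsub>BijGroup X\<^esub> (k::nat) = restrict (g ^^ k) X"
proof (induction k)
  case 0
  then show ?case
    by (simp add: BijGroup_def restrict_def fun_eq_iff)
next
  case (Suc k)
  interpret group "BijGroup X"
    by (rule group_BijGroup)
  have carrier: "carrier (BijGroup X) = Bij X"
    by (simp add: BijGroup_def)
  have "restrict (g ^^ k) X \<in> Bij X"
    using nat_pow_closed[of g k] assms by (simp only: Suc carrier)
  moreover have "g [^]\<^bsub>BijGroup X\<^esub> Suc k = restrict (g ^^ k) X \<otimes>\<^bsub>BijGroup X\<^esub> g"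
    by (simp only: nat_pow_Suc Suc)
  ultimately have "g [^]\<^bsub>BijGroup X\<^esub> Suc k = compose X (restrict (g ^^ k) X) g"
    using assms by (simp only:) (simp add: BijGroup_def)
  also have "\<dots> = restrict (g ^^ Suc k) X"
    using Bij_imp_funcset[OF assms]
    by (auto simp: compose_def restrict_def fun_eq_iff funpow_swap1 Pi_iff)
  finally show ?case .
qed

text \<open>The hypotheses on powers of \<open>g\<close> force its order to be exactly
  \<open>n\<close>, hence also that of the generated group, which acts through its inclusion into
  \<open>BijGroup X\<close>.\<close>

lemma cyclic_sieving_perm_group_generatedI:
  assumes "finite X" and g: "g \<in> Bij X" and "n > 0"
    and id: "\<And>x. x \<in> X \<Longrightarrow> (g ^^ n) x = x"
    and not_id: "\<And>k. 0 < k \<Longrightarrow> k < n \<Longrightarrow> \<exists>x\<in>X. (g ^^ k) x \<noteq> x"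
    and "\<And>i. coeff f i \<in> \<nat>"
    and f: "\<And>k. k \<in> {1..n} \<Longrightarrow> poly f (exp (2 * complex_of_real pi * \<i> / of_nat n) ^ k)
      = of_nat (card {x \<in> X. (g ^^ k) x = x})"
  shows "cyclic_sieving n X (perm_group_generated X g) g (\<lambda>h. h) f"
proof -
  interpret B: group "BijGroup X"
    by (rule group_BijGroup)
  let ?G = "subgroup_generated (BijGroup X) {g}"
  have gc: "g \<in> carrier (BijGroup X)"
    using g by (simp add: BijGroup_def)
  have one: "g [^]\<^bsub>BijGroup X\<^esub> k = \<one>\<^bsub>BijGroup X\<^esub> \<longleftrightarrow> (\<forall>x\<in>X. (g ^^ k) x = x)" for k :: nat
    by (simp add: BijGroup_pow[OF g]) (auto simp: BijGroup_def restrict_def fun_eq_iff)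
  have "B.ord g dvd n"
    using id one B.pow_eq_id[OF gc, of n] by simp
  moreover have "\<not> B.ord g < n"
  proof
    assume "B.ord g < n"
    moreover have "B.ord g > 0"
      using \<open>B.ord g dvd n\<close> \<open>n > 0\<close> by (intro Nat.gr0I) auto
    ultimately show False
      using not_id[of "B.ord g"] one[of "B.ord g"] B.pow_ord_eq_1[OF gc] by auto
  qed
  ultimately have ord: "B.ord g = n"
    using \<open>n > 0\<close> by (meson dvd_imp_le le_neq_implies_less)
  have car: "carrier ?G = generate (BijGroup X) {g}"
    using gc by (simp add: carrier_subgroup_generated)
  have card: "card (carrier ?G) = n"
    using B.generate_pow_card[OF gc] ord car by simp
  have "group_hom ?G (BijGroup X) (\<lambda>h. h)"
    using B.group_subgroup_generated[of "{g}"] B.carrier_subgroup_generated_subset[of "{g}"]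
    by (auto simp: group_hom_def group_hom_axioms_def hom_def group_BijGroup)
  then have act: "group_action ?G X (\<lambda>h. h)"
    by (simp add: group_action_def)
  have "{x \<in> X. (g [^]\<^bsub>?G\<^esub> k) x = x} = {x \<in> X. (g ^^ k) x = x}" for k :: nat
    by (auto simp: pow_subgroup_generated BijGroup_pow[OF g])
  moreover have "g \<in> carrier ?G"
    unfolding car by (simp add: generate.incl)
  moreover have "subgroup_generated ?G {g} = ?G"
    by (simp add: B.subgroup_generated2)
  moreover have "finite (carrier ?G)"
    using card \<open>n > 0\<close> by (simp add: card_ge_0_finite)
  ultimately show ?thesis
    using assms act card f by (simp add: cyclic_sieving_def perm_group_generated_def Coset.order_def)
qed

text \<open>The second conjunct carries the induction: \<open>inv_into\<close> cancels
  \<open>M_map\<close> only on \<open>OBW n\<close>.\<close>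

lemma eta_tilde_funpow_M_map:
  assumes "n \<ge> 1" "b \<in> OBW n"
  shows "(eta_tilde n ^^ k) (M_map b) = M_map ((eta ^^ k) b) \<and> (eta ^^ k) b \<in> OBW n"
proof (induction k)
  case (Suc k)
  note M = bij_betw_M_map[OF assms(1)]
  let ?c = "(eta ^^ k) b"
  have "eta_tilde n (M_map ?c) = M_map (eta ?c)"
    using M Suc by (auto simp: eta_tilde_def bij_betw_def inv_into_f_f)
  then show ?case
    using Suc eta_OBW by auto
qed (simp add: assms)

lemma card_eta_tilde_fixed:
  assumes "n \<ge> 1"
  shows "card {x \<in> CMP n. (eta_tilde n ^^ k) x = x} = card {b \<in> OBW n. (eta ^^ k) b = b}"
proof -
  note M = bij_betw_M_map[OF assms]
  have iff: "(eta_tilde n ^^ k) (M_map b) = M_map b \<longleftrightarrow> (eta ^^ k) b = b" if "b \<in> OBW n" for b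
    using eta_tilde_funpow_M_map[OF assms that, of k] M that
    by (auto simp: bij_betw_def inj_on_def)
  have "M_map ` {b \<in> OBW n. (eta ^^ k) b = b} = {x \<in> CMP n. (eta_tilde n ^^ k) x = x}"
  proof (intro equalityI subsetI)
    fix x assume "x \<in> {x \<in> CMP n. (eta_tilde n ^^ k) x = x}"
    then have "x \<in> M_map ` OBW n" and x: "(eta_tilde n ^^ k) x = x"
      using bij_betw_imp_surj_on[OF M] by simp_all
    then obtain b where "b \<in> OBW n" "x = M_map b"
      by blast
    with x show "x \<in> M_map ` {b \<in> OBW n. (eta ^^ k) b = b}"
      using iff[of b] by simp
  qed (use M iff in \<open>auto simp: bij_betw_def\<close>)
  moreover have "inj_on M_map {b \<in> OBW n. (eta ^^ k) b = b}"
    by (rule inj_on_subset[OF bij_betw_imp_inj_on[OF M]]) auto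
  ultimately show ?thesis
    using card_image by fastforce
qed

text \<open>A common criterion for both polynomials: sieving looks only at values at
  \<open>n\<close>-th roots of unity, where the product and the fixed point count agree in either
  parity case.\<close>

lemma cyclic_sieving_CMP:
  assumes "n \<ge> 1" and "\<And>i. coeff f i \<in> \<nat>"
    and f: "\<And>z. z ^ n = 1 \<Longrightarrow> poly f z = (\<Prod>i\<in>{1..<n}. 1 + z ^ i)"
  shows "cyclic_sieving n (CMP n) (perm_group_generated (CMP n) (eta_tilde n)) (eta_tilde n) (\<lambda>h. h) f"
proof (rule cyclic_sieving_perm_group_generatedI)
  note M = bij_betw_M_map[OF assms(1)]
  have n: "n > 0"
    using assms(1) by simp
  have fin: "finite (OBW n)"
    using finite_binary_words by (auto simp: OBW_def)
  then show finCMP: "finite (CMP n)"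
    using M bij_betw_finite by blast
  show id: "(eta_tilde n ^^ n) x = x" if "x \<in> CMP n" for x
  proof -
    obtain b where "b \<in> OBW n" "x = M_map b"
      using \<open>x \<in> CMP n\<close> bij_betw_imp_surj_on[OF M] by blast
    then show ?thesis
      using eta_tilde_funpow_M_map[OF assms(1), of b n] eta_funpow_id[OF _ n] by (simp add: OBW_def)
  qed
  have maps: "(eta_tilde n ^^ k) x \<in> CMP n" if "x \<in> CMP n" for k x
  proof -
    obtain b where "b \<in> OBW n" "x = M_map b"
      using \<open>x \<in> CMP n\<close> bij_betw_imp_surj_on[OF M] by blast
    then show ?thesis
      using eta_tilde_funpow_M_map[OF assms(1), of b k] M by (auto simp: bij_betw_def)
  qed
  \<comment> \<open>Since the \<open>n\<close>-th power is the identity, the power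
    \<open>n - 1\<close> is the inverse.\<close>
  have "bij_betw (eta_tilde n) (CMP n) (CMP n)"
  proof (rule bij_betw_byWitness[where f' = "eta_tilde n ^^ (n - 1)"])
    have Suc: "eta_tilde n ^^ n = eta_tilde n ^^ Suc (n - 1)"
      using n by simp
    show "\<forall>x\<in>CMP n. (eta_tilde n ^^ (n - 1)) (eta_tilde n x) = x"
      using id by (simp only: Suc funpow_Suc_right o_def) simp
    show "\<forall>x\<in>CMP n. eta_tilde n ((eta_tilde n ^^ (n - 1)) x) = x"
      using id by (simp only: Suc funpow.simps o_def) simp
    show "eta_tilde n ` CMP n \<subseteq> CMP n" "(eta_tilde n ^^ (n - 1)) ` CMP n \<subseteq> CMP n"
      using maps[of _ 1] maps[of _ "n - 1"] by auto
  qed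
  then show "eta_tilde n \<in> Bij (CMP n)"
    by (simp add: Bij_def eta_tilde_def)
  have fixed: "card {x \<in> CMP n. (eta_tilde n ^^ k) x = x}
      = (if even (n div gcd n k) then 0 else 2 ^ (gcd n k - 1))" for k
    using card_eta_tilde_fixed[OF assms(1)] card_eta_funpow_fixed[OF n refl] by simp
  \<comment> \<open>The fixed point formula itself gives faithfulness: for \<open>k = n\<close> it
    counts all \<open>2 ^ (n - 1)\<close> words, whereas \<open>gcd n k < n\<close> makes the count
    smaller for the present \<open>k\<close>.\<close>
  show "\<exists>x\<in>CMP n. (eta_tilde n ^^ k) x \<noteq> x" if k: "0 < k" "k < n" for k
  proof (rule ccontr)
    assume "\<not> ?thesis"
    then have "{x \<in> CMP n. (eta_tilde n ^^ k) x = x} = CMP n"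
      by auto
    moreover have "{x \<in> CMP n. (eta_tilde n ^^ n) x = x} = CMP n"
      using id by auto
    ultimately have "(if even (n div gcd n k) then 0 else 2 ^ (gcd n k - 1) :: nat) = 2 ^ (n - 1)"
      using fixed[of k] fixed[of n] n by simp
    then have "gcd n k - 1 = n - 1"
      by (auto split: if_splits)
    moreover have "gcd n k \<le> k"
      using k by (auto intro: dvd_imp_le)
    moreover have "gcd n k > 0"
      using k by simp
    ultimately show False
      using k by linarith
  qed
  show "poly f (exp (2 * complex_of_real pi * \<i> / of_nat n) ^ k)
      = of_nat (card {x \<in> CMP n. (eta_tilde n ^^ k) x = x})" if "k \<in> {1..n}" for k
  proof -
    define z where "z = exp (2 * complex_of_real pi * \<i> / of_nat n) ^ k"
    define m where "m = gcd n k"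
    define d where "d = n div m"
    have z: "primitive_root_of_unity d z"
      unfolding z_def d_def m_def by (rule primitive_root_of_unity_exp_power[OF assms(1)])
    have md: "m * d = n" "m > 0"
      using n by (auto simp: m_def d_def)
    have "d dvd n"
      unfolding md(1)[symmetric] by (rule dvd_triv_right)
    have "d > 0"
      by (rule dvd_pos_nat[OF n \<open>d dvd n\<close>])
    have "z ^ n = 1"
      using z \<open>d dvd n\<close> unfolding primitive_root_of_unity_def by blast
    then have "poly f z = (\<Prod>i\<in>{1..<n}. 1 + z ^ i)"
      by (rule f)
    also have "\<dots> = (if even d then 0 else 2 ^ (m - 1))"
    proof (cases "even d")
      case True
      then show ?thesis
        using prod_one_plus_primitive_root_even[OF z True \<open>d > 0\<close> \<open>d dvd n\<close> n] by simp
    next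
      case False
      then show ?thesis
        using prod_one_plus_primitive_root[OF z False md(2)] unfolding md(1) by simp
    qed
    also have "\<dots> = of_nat (card {x \<in> CMP n. (eta_tilde n ^^ k) x = x})"
      unfolding fixed by (simp add: m_def d_def)
    finally show ?thesis
      by (simp add: z_def)
  qed
qed (use assms in auto)

theorem theorem6p6:
  fixes n :: nat
  assumes "n \<ge> 1"
  shows "bij_betw M_map (OBW n) (CMP n)
    \<and> eta \<in> OBW n \<rightarrow> OBW n
    \<and> cyclic_sieving n (CMP n) (perm_group_generated (CMP n) (eta_tilde n)) (eta_tilde n) (\<lambda>h. h)
        (smult (1 / 2) (\<Sum>k=0..n. monom 1 (k choose 2) * q_binomial n k))
    \<and> cyclic_sieving n (CMP n) (perm_group_generated (CMP n) (eta_tilde n)) (eta_tilde n) (\<lambda>h. h)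
        (\<Sum>b\<in>CMP n. monom 1 (maj b))"
proof (intro conjI)
  show "bij_betw M_map (OBW n) (CMP n)"
    by (rule bij_betw_M_map[OF assms])
  show "eta \<in> OBW n \<rightarrow> OBW n"
    by (rule eta_OBW)
  show "cyclic_sieving n (CMP n) (perm_group_generated (CMP n) (eta_tilde n)) (eta_tilde n) (\<lambda>h. h)
      (smult (1 / 2) (\<Sum>k=0..n. monom 1 (k choose 2) * q_binomial n k))"
    unfolding half_q_binomial_sum[OF assms]
  proof (rule cyclic_sieving_CMP[OF assms])
    show "coeff (\<Prod>i\<in>{1..<n}. 1 + monom (1::complex) i) j \<in> \<nat>" for j
      by (rule coeff_prod_in_Nats) (auto simp: coeff_1)
    show "poly (\<Prod>i\<in>{1..<n}. 1 + monom 1 i) z = (\<Prod>i\<in>{1..<n}. 1 + z ^ i)" for z :: complex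
      by (simp add: poly_prod poly_monom)
  qed
  show "cyclic_sieving n (CMP n) (perm_group_generated (CMP n) (eta_tilde n)) (eta_tilde n) (\<lambda>h. h)
      (\<Sum>b\<in>CMP n. monom 1 (maj b))"
  proof (rule cyclic_sieving_CMP[OF assms])
    show "coeff (\<Sum>b\<in>CMP n. monom (1::complex) (maj b)) i \<in> \<nat>" for i
      by (auto simp: coeff_sum intro!: sum_in_Nats)
    show "poly (\<Sum>b\<in>CMP n. monom 1 (maj b)) z = (\<Prod>i\<in>{1..<n}. 1 + z ^ i)" if "z ^ n = 1" for z :: complex
      using sum_power_maj_CMP[OF assms that] by (simp add: poly_sum poly_monom)
  qed
qed

end
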